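(* Let $\mathbb{F}_q$ be the finite field with $q$ elements, of characteristic $p$, let $\mathbb{F}_p\subseteq\mathbb{F}_q$ be its prime field, let $k\ge 2$ be an integer, and let $a_1,a_2,b\in\mathbb{F}_q$. (1) If $a_1+a_2+k-2\neq 0$ in $\mathbb{F}_q$, then $$N_{\mathbb{F}_q}(a_1,a_2,\underbrace{1,\dots,1}_{k-2};b)=\frac{1}{q}(q)_k.$$ (2) If $a_1+a_2+k-2=0$ in $\mathbb{F}_q$ and $a_1,a_2\notin\mathbb{F}_p$, then $$N_{\mathbb{F}_q}(a_1,a_2,\underbrace{1,\dots,1}_{k-2};b)=\frac{1}{q}(q)_k+v(b)(-1)^{k-1+\lfloor\frac{k-2}{p}\rfloor}(k-2)!\left(\frac{q\{k-2\}_p-p(k-2)}{q-p}+1\right)\binom{q/p-1}{\lfloor (k-2)/p\rfloor}.$$ (3) If $a_1+a_2+k-2=0$ in $\mathbb{F}_q$ and $a_1,a_2\in\mathbb{F}_p$, then $$N_{\mathbb{F}_q}(a_1,a_2,\underbrace{1,\dots,1}_{k-2};b)=\frac{1}{q}(q)_k+v(b)(-1)^{k-1+\lfloor\frac{k-1}{p}\rfloor}(k-2)!\,\bigl(k-1-q\,1_A(a_1,a_2)\bigr)\binom{q/p-1}{\lfloor (k-1)/p\rfloor},$$ where $A=\{(a_1,a_2)\in\mathbb{F}_p^2: a_1\neq 1,\ a_2\neq 1\ \text{and}\ \{1-a_1\}_p+\{1-a_2\}_p\leq p\}$.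
   Context: For $a_1,\ldots,a_k,b\in\mathbb{F}_q$, $N_{\mathbb{F}_q}(a_1,\ldots,a_k;b)$ denotes the number of tuples $(x_1,\ldots,x_k)\in\mathbb{F}_q^k$ with $x_i\ne x_j$ for all $i\neq j$ and $a_1x_1+\cdots+a_kx_k=b$. The function $v:\mathbb{F}_q\to\mathbb{Z}$ is defined by $v(b)=-1$ if $b\neq 0$ and $v(0)=q-1$. $(q)_k=q(q-1)\cdots(q-k+1)$ is the falling factorial. For an integer $x$, $\{x\}_p=x-\lfloor x/p\rfloor p$ is the least non-negative residue of $x$ modulo $p$; for $x\in\mathbb{F}_p$, $\{x\}_p\in\{0,1,\ldots,p-1\}$ is the least non-negative integer representing $x$. $1_A$ is the indicator function of $A$. Integers such as $k-2$ are regarded as elements of $\mathbb{F}_q$ via $\mathbb{Z}\to\mathbb{F}_q$ when added to elements of $\mathbb{F}_q$. *)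

theory Defs
  imports Complex_Main "HOL-Library.Cardinality" "HOL-Library.Indicator_Function"
begin

definition num_distinct_sols :: "'a::{field, finite} list \<Rightarrow> 'a \<Rightarrow> nat" where
  "num_distinct_sols as b =
     card {xs. length xs = length as \<and> distinct xs \<and> (\<Sum>i<length as. as ! i * xs ! i) = b}"

definition v_fun :: "'a::{field, finite} \<Rightarrow> int" where
  "v_fun b = (if b = 0 then int CARD('a) - 1 else - 1)"

definition falling_fact :: "nat \<Rightarrow> nat \<Rightarrow> rat" where
  "falling_fact q k = (\<Prod>i<k. of_nat q - of_nat i)"

text \<open>The prime field, i.e. the image of the canonical map from the integers.
  This image is a subfield because a finite field has prime characteristic.\<close>

definition prime_field :: "'a::{field, finite} set" where
  "prime_field = range of_int"

text \<open>The least non-negative integer representing \<open>x\<close>; meaningful only for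
  \<open>x \<in> prime_field\<close>.\<close>

definition least_residue :: "'a::{field, finite} \<Rightarrow> nat" where
  "least_residue x = (LEAST n. of_nat n = x)"

definition A_set :: "('a::{field, finite} \<times> 'a) set" where
  "A_set = {(a1, a2). a1 \<in> prime_field \<and> a2 \<in> prime_field \<and> a1 \<noteq> 1 \<and> a2 \<noteq> 1 \<and>
     least_residue (1 - a1) + least_residue (1 - a2) \<le> CHAR('a)}"

end

theory Submission
  imports Defs "HOL-Number_Theory.Residues" "HOL-Combinatorics.Permutations"
begin

text \<open>
  Scaling the unknowns shows that \<open>N(as; b)\<close> takes one value for all \<open>b \<noteq> 0\<close>, so it is
  determined by the gap \<open>W(as) = N(as; 0) - N(as; 1)\<close>; translating them shows that \<open>W(as) = 0\<close> unless
  the coefficients sum to zero. Solving for the first unknown gives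
  \<open>W(a # as) = q [a = 0] W(as) - (\<Sum>i. W(as[i := as ! i + a]))\<close>.
  On coefficient lists that consist of at most two free entries followed by \<open>m\<close> ones, the
  normalised gap \<open>(- 1)^m W / m!\<close> therefore telescopes in \<open>m\<close>. With \<open>Q = q / p\<close> and
  \<open>\<gamma> t = (- 1)^t (Q - 1 choose t)\<close>, its partial sums over lists of ones only are \<open>\<gamma> (m div p)\<close>, and for
  two free entries of the right sum it equals
  \<open>q (\<Sum>j\<le>m. (q [a2 + j = 0] - 1) \<gamma> (j div p))\<close>, which is summed in closed form by
  \<open>(t + 1) \<gamma> (t + 1) = (t + 1 - Q) \<gamma> t\<close>.
\<close>

section \<open>Tuples with distinct entries and elimination of one unknown\<close>

definition dlists :: "nat \<Rightarrow> 'a list set" where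
  "dlists n = {xs. length xs = n \<and> distinct xs}"

definition dot :: "'a::comm_ring_1 list \<Rightarrow> 'a list \<Rightarrow> 'a" where
  "dot as xs = (\<Sum>i<length as. as ! i * xs ! i)"

lemma finite_dlists [simp]: "finite (dlists n :: 'a::finite list set)"
  by (rule finite_subset[OF _ finite_lists_length_eq[of "UNIV :: 'a set" n]])
     (auto simp: dlists_def)

lemma dlists_0 [simp]: "dlists 0 = {[]}"
  by (auto simp: dlists_def)

lemma num_distinct_sols_conv_sum:
  "of_nat (num_distinct_sols as b) =
     (\<Sum>xs\<in>dlists (length as). of_bool (dot as xs = b) :: rat)"
proof -
  have "{xs. length xs = length as \<and> distinct xs \<and> (\<Sum>i<length as. as ! i * xs ! i) = b} =
      {xs \<in> dlists (length as). dot as xs = b}"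
    by (auto simp: dlists_def dot_def)
  then show ?thesis
    by (simp add: num_distinct_sols_def Int_def)
qed

text \<open>Given the tail, a new head runs over the whole field minus the values already used;
  distinctness of the tail makes these exactly \<open>n\<close> separate values. The subtractive
  form leaves an unrestricted inner sum over \<open>x\<close> that can be evaluated.\<close>

lemma sum_dlists_Suc:
  fixes f :: "'a::finite list \<Rightarrow> 'b::ab_group_add"
  shows "(\<Sum>xs\<in>dlists (Suc n). f xs) =
    (\<Sum>ys\<in>dlists n. (\<Sum>x\<in>UNIV. f (x # ys)) - (\<Sum>i<n. f (ys ! i # ys)))"
proof -
  have eq: "dlists (Suc n) = (\<lambda>(ys, x). x # ys) ` (SIGMA ys : dlists n. UNIV - set ys)"
    by (auto simp: dlists_def image_iff length_Suc_conv)
  have "(\<Sum>xs\<in>dlists (Suc n). f xs) = (\<Sum>(ys, x)\<in>(SIGMA ys : dlists n. UNIV - set ys). f (x # ys))"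
    unfolding eq by (subst sum.reindex) (auto simp: inj_on_def case_prod_unfold)
  also have "\<dots> = (\<Sum>ys\<in>dlists n. \<Sum>x\<in>UNIV - set ys. f (x # ys))"
    by (rule sum.Sigma[symmetric]) auto
  also have "\<dots> = (\<Sum>ys\<in>dlists n. (\<Sum>x\<in>UNIV. f (x # ys)) - (\<Sum>i<n. f (ys ! i # ys)))"
  proof (rule sum.cong[OF refl])
    fix ys :: "'a list" assume "ys \<in> dlists n"
    then have ys: "length ys = n" "distinct ys" by (auto simp: dlists_def)
    have "(\<Sum>x\<in>set ys. f (x # ys)) = (\<Sum>i<n. f (ys ! i # ys))"
      using bij_betw_nth[OF ys(2) _ refl, of "{..<n}"] ys
      by (intro sum.reindex_bij_betw[symmetric]) auto
    then show "(\<Sum>x\<in>UNIV - set ys. f (x # ys)) =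
        (\<Sum>x\<in>UNIV. f (x # ys)) - (\<Sum>i<n. f (ys ! i # ys))"
      by (simp add: sum_diff)
  qed
  finally show ?thesis .
qed

lemma card_dlists:
  "of_nat (card (dlists n :: 'a::finite list set)) = falling_fact CARD('a) n"
proof (induction n)
  case (Suc n)
  have "of_nat (card (dlists (Suc n) :: 'a list set)) = (\<Sum>xs\<in>(dlists (Suc n) :: 'a list set). 1 :: rat)"
    by simp
  also have "\<dots> = of_nat (card (dlists n :: 'a list set)) * (of_nat CARD('a) - of_nat n)"
    by (subst sum_dlists_Suc) simp
  finally show ?case by (simp add: Suc falling_fact_def)
qed (simp add: falling_fact_def)

lemma dot_Cons [simp]: "dot (a # as) (x # xs) = a * x + dot as xs"
  by (simp add: dot_def sum.lessThan_Suc_shift del: sum.lessThan_Suc)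

lemma dot_update:
  assumes "i < length as"
  shows "dot (as[i := as ! i + a]) ys = a * ys ! i + dot as ys"
proof -
  have "dot (as[i := as ! i + a]) ys =
      (\<Sum>j<length as. as ! j * ys ! j + (if j = i then a * ys ! i else 0))"
    unfolding dot_def by (auto intro!: sum.cong simp: nth_list_update algebra_simps)
  then show ?thesis using assms by (simp add: sum.distrib dot_def)
qed

text \<open>A forbidden coincidence of the first unknown with \<open>ys ! i\<close> merges its
  coefficient into \<open>as ! i\<close>, so every correction term is again a count of the same kind
  with one unknown fewer.\<close>

lemma num_distinct_sols_Cons:
  fixes a :: "'a::{field, finite}"
  shows "of_nat (num_distinct_sols (a # as) b) =
    (\<Sum>ys\<in>dlists (length as). (\<Sum>x\<in>UNIV. of_bool (a * x + dot as ys = b)))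
    - (\<Sum>i<length as. of_nat (num_distinct_sols (as[i := as ! i + a]) b) :: rat)"
proof -
  have "(\<Sum>i<length as. of_nat (num_distinct_sols (as[i := as ! i + a]) b)) =
      (\<Sum>i<length as. \<Sum>ys\<in>dlists (length as). of_bool (dot (a # as) (ys ! i # ys) = b) :: rat)"
    by (intro sum.cong) (simp_all add: num_distinct_sols_conv_sum dot_update)
  also have "\<dots> = (\<Sum>ys\<in>dlists (length as). \<Sum>i<length as. of_bool (dot (a # as) (ys ! i # ys) = b))"
    by (rule sum.swap)
  finally show ?thesis
    by (simp only: num_distinct_sols_conv_sum[of "a # as"] list.size add_Suc_right add_0_right
          sum_dlists_Suc sum_subtractf dot_Cons)
qed

section \<open>Symmetries of the count: permutations and affine substitutions\<close>

lemma num_distinct_sols_mset: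
  fixes as :: "'a::{field, finite} list"
  assumes "mset as = mset bs"
  shows "num_distinct_sols as b = num_distinct_sols bs b"
proof -
  obtain \<pi> where \<pi>: "\<pi> permutes {..<length bs}" "permute_list \<pi> bs = as"
    using mset_eq_permutation[OF assms] by blast
  have len: "length as = length bs" using assms by (rule mset_eq_length)
  have dot: "dot as (permute_list \<pi> xs) = dot bs xs" if "length xs = length bs" for xs
  proof -
    have "dot as (permute_list \<pi> xs) = (\<Sum>i<length bs. bs ! \<pi> i * xs ! \<pi> i)"
      unfolding dot_def len
    proof (rule sum.cong[OF refl])
      fix i assume "i \<in> {..<length bs}"
      then show "as ! i * permute_list \<pi> xs ! i = bs ! \<pi> i * xs ! \<pi> i"
        using \<pi> that by (auto simp: permute_list_nth)
    qed
    also have "\<dots> = dot bs xs"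
      unfolding dot_def using \<pi>(1)
      by (intro sum.reindex_bij_betw[OF permutes_imp_bij, of _ _ "\<lambda>i. bs ! i * xs ! i"])
    finally show ?thesis .
  qed
  have bij: "bij_betw (permute_list \<pi>) (dlists (length bs)) (dlists (length bs) :: 'a list set)"
  proof (rule bij_betwI[where g = "permute_list (inv_into UNIV \<pi>)"])
    note inv = permutes_inv[OF \<pi>(1)]
    show "permute_list (inv_into UNIV \<pi>) (permute_list \<pi> xs) = xs"
      if "xs \<in> dlists (length bs)" for xs :: "'a list"
      using that \<pi>(1) inv permute_list_compose[of "inv_into UNIV \<pi>" xs \<pi>]
      by (auto simp: dlists_def permutes_inv_o)
    show "permute_list \<pi> (permute_list (inv_into UNIV \<pi>) xs) = xs"
      if "xs \<in> dlists (length bs)" for xs :: "'a list"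
      using that \<pi>(1) inv permute_list_compose[of "\<pi>" xs "inv_into UNIV \<pi>"]
      by (auto simp: dlists_def permutes_inv_o)
  qed (use \<pi>(1) permutes_inv[OF \<pi>(1)] in \<open>auto simp: dlists_def\<close>)
  have "(of_nat (num_distinct_sols as b) :: rat) = of_nat (num_distinct_sols bs b)"
    unfolding num_distinct_sols_conv_sum len
    by (subst sum.reindex_bij_betw[OF bij, symmetric])
       (auto intro!: sum.cong simp: dot dlists_def)
  then show ?thesis by simp
qed

lemma sum_num_distinct_sols:
  "(\<Sum>b\<in>UNIV. of_nat (num_distinct_sols (as :: 'a::{field, finite} list) b)) =
    falling_fact CARD('a) (length as)"
proof -
  have "(\<Sum>b\<in>UNIV. of_nat (num_distinct_sols as b)) =
      (\<Sum>xs\<in>dlists (length as). \<Sum>b\<in>UNIV. of_bool (dot as xs = b) :: rat)"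
    unfolding num_distinct_sols_conv_sum by (rule sum.swap)
  also have "\<dots> = of_nat (card (dlists (length as) :: 'a list set))"
    by (simp add: of_bool_def)
  finally show ?thesis by (simp add: card_dlists)
qed

lemma dot_map_affine:
  assumes "length xs = length as"
  shows "dot as (map (\<lambda>x. c * x + d) xs) = c * dot as xs + d * sum_list as"
proof -
  have "dot as (map (\<lambda>x. c * x + d) xs) = (\<Sum>i<length as. c * (as ! i * xs ! i) + d * as ! i)"
    unfolding dot_def using assms by (auto intro!: sum.cong simp: algebra_simps)
  then show ?thesis
    by (simp add: dot_def sum.distrib sum_distrib_left sum_list_sum_nth atLeast0LessThan)
qed

text \<open>Applying the bijection \<open>x \<mapsto> c * x + d\<close> to every unknown preserves
  distinctness. Taking \<open>d = 0\<close> identifies all nonzero right-hand sides; taking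
  \<open>c = 1\<close> identifies all right-hand sides once the coefficient sum is nonzero.\<close>

lemma num_distinct_sols_affine:
  fixes as :: "'a::{field, finite} list"
  assumes "c \<noteq> 0"
  shows "num_distinct_sols as (c * b + d * sum_list as) = num_distinct_sols as b"
proof -
  have bij: "bij_betw (map (\<lambda>x. c * x + d)) (dlists (length as)) (dlists (length as) :: 'a list set)"
    using assms
    by (intro bij_betwI[where g = "map (\<lambda>x. (x - d) / c)"])
       (auto simp: dlists_def distinct_map inj_on_def map_idI o_def)
  have "(of_nat (num_distinct_sols as (c * b + d * sum_list as)) :: rat) =
      of_nat (num_distinct_sols as b)"
    unfolding num_distinct_sols_conv_sum
    by (subst sum.reindex_bij_betw[OF bij, symmetric])
       (use assms in \<open>auto intro!: sum.cong simp: dot_map_affine dlists_def\<close>)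
  then show ?thesis by simp
qed

lemma num_distinct_sols_uniform:
  fixes as :: "'a::{field, finite} list"
  assumes "sum_list as \<noteq> 0"
  shows "num_distinct_sols as b = num_distinct_sols as b'"
  using num_distinct_sols_affine[of 1 as b' "(b - b') / sum_list as"] assms by simp

lemma num_distinct_sols_nonzero:
  fixes as :: "'a::{field, finite} list"
  assumes "b \<noteq> 0"
  shows "num_distinct_sols as b = num_distinct_sols as 1"
  using num_distinct_sols_affine[of b as 1 0] assms by simp

section \<open>The gap between the homogeneous and the inhomogeneous count\<close>

definition sol_gap :: "'a::{field, finite} list \<Rightarrow> rat" where
  "sol_gap as = of_nat (num_distinct_sols as 0) - of_nat (num_distinct_sols as 1)"

text \<open>There are only two unknown values, at \<open>0\<close> and at \<open>1\<close>. Their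
  weighted sum with weights \<open>1\<close> and \<open>q - 1\<close> is the falling factorial and
  their difference is the gap; solving this linear system produces \<open>v_fun\<close>.\<close>

lemma num_distinct_sols_conv_sol_gap:
  fixes as :: "'a::{field, finite} list"
  shows "of_nat (num_distinct_sols as b) =
    falling_fact CARD('a) (length as) / of_nat CARD('a) +
    of_int (v_fun b) * sol_gap as / of_nat CARD('a)"
proof -
  define q where "q = (of_nat CARD('a) :: rat)"
  have q: "q \<noteq> 0" by (simp add: q_def)
  have "falling_fact CARD('a) (length as) = of_nat (num_distinct_sols as 0) +
      (\<Sum>b\<in>UNIV - {0}. of_nat (num_distinct_sols as b))"
    unfolding sum_num_distinct_sols[symmetric] by (rule sum.remove) auto
  also have "(\<Sum>b\<in>UNIV - {0}. of_nat (num_distinct_sols as b)) =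
      (\<Sum>b\<in>UNIV - {0::'a}. of_nat (num_distinct_sols as 1) :: rat)"
    by (rule sum.cong) (auto intro!: num_distinct_sols_nonzero)
  also have "\<dots> = (q - 1) * of_nat (num_distinct_sols as 1)"
    by (simp add: q_def card_Diff_singleton Suc_le_eq)
  finally have F: "falling_fact CARD('a) (length as) =
      of_nat (num_distinct_sols as 0) + (q - 1) * of_nat (num_distinct_sols as 1)" .
  have v: "of_int (v_fun b) = q * of_bool (b = 0) - 1"
    by (simp add: v_fun_def q_def)
  have "q * of_nat (num_distinct_sols as b) =
      falling_fact CARD('a) (length as) + of_int (v_fun b) * sol_gap as"
    unfolding F sol_gap_def v using num_distinct_sols_nonzero[of b as]
    by (cases "b = 0") (simp_all add: algebra_simps)
  then show ?thesis
    using q by (simp add: q_def[symmetric] eq_divide_eq mult.commute flip: add_divide_distrib)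
qed

lemma sol_gap_eq_0: "sum_list as \<noteq> 0 \<Longrightarrow> sol_gap as = 0"
  using num_distinct_sols_uniform[of as 0 1] by (simp add: sol_gap_def)

lemma sol_gap_Nil [simp]: "sol_gap [] = 1"
  by (simp add: sol_gap_def num_distinct_sols_conv_sum dot_def)

lemma sol_gap_mset: "mset as = mset bs \<Longrightarrow> sol_gap as = sol_gap bs"
  by (simp add: sol_gap_def num_distinct_sols_mset[of as bs])

text \<open>Choosing the variable with coefficient \<open>a\<close> last: without the distinctness constraints
  on it, the count does not depend on the right-hand side unless \<open>a = 0\<close>.\<close>

lemma sol_gap_Cons:
  fixes a :: "'a::{field, finite}"
  shows "sol_gap (a # as) = of_bool (a = 0) * of_nat CARD('a) * sol_gap as
    - (\<Sum>i<length as. sol_gap (as[i := as ! i + a]))"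
proof -
  have "(\<Sum>x\<in>UNIV. of_bool (a * x + d = b)) =
      (if a = 0 then of_nat CARD('a) * of_bool (d = b) else (1 :: rat))" for b d
  proof (cases "a = 0")
    case False
    then have "(a * x + d = b) = (x = (b - d) / a)" for x
      by (auto simp: field_simps)
    then show ?thesis using False by (simp add: of_bool_def)
  qed simp
  then have "(\<Sum>ys\<in>dlists (length as). \<Sum>x\<in>UNIV. of_bool (a * x + dot as ys = b)) =
      (if a = 0 then of_nat CARD('a) * of_nat (num_distinct_sols as b)
       else (of_nat (card (dlists (length as) :: 'a list set)) :: rat))" for b
    by (simp only: num_distinct_sols_conv_sum sum_distrib_left) simp
  then show ?thesis
    unfolding sol_gap_def num_distinct_sols_Cons
    by (simp add: sum_subtractf algebra_simps)
qed

section \<open>Coefficient lists with a tail of ones\<close>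

definition norm_gap :: "'a::{field, finite} list \<Rightarrow> nat \<Rightarrow> rat" where
  "norm_gap as m = (- 1) ^ m * sol_gap (as @ replicate m 1) / fact m"

lemma norm_gap_eq_0: "sum_list as + of_nat m \<noteq> 0 \<Longrightarrow> norm_gap as m = 0"
  by (simp add: norm_gap_def sol_gap_eq_0 sum_list_replicate)

text \<open>Whichever of the \<open>m\<close> ones absorbs \<open>a\<close>, the resulting multiset
  is the same: \<open>a + 1\<close> together with \<open>m - 1\<close> ones. The sign and the
  factorial in \<open>norm_gap\<close> turn these \<open>m\<close> equal terms into a single one
  with coefficient \<open>1\<close>.\<close>

lemma norm_gap_Cons:
  fixes a :: "'a::{field, finite}"
  shows "norm_gap (a # as) m = of_bool (a = 0) * of_nat CARD('a) * norm_gap as m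
    - (\<Sum>i<length as. norm_gap (as[i := as ! i + a]) m)
    + (if m = 0 then 0 else norm_gap ((a + 1) # as) (m - 1))"
proof -
  let ?r = "replicate m (1 :: 'a)"
  have tail: "sol_gap (as @ ?r[i := ?r ! i + a]) = sol_gap ((a + 1) # as @ replicate (m - 1) 1)"
    if "i < m" for i
  proof (rule sol_gap_mset)
    have "mset (?r[i := ?r ! i + a]) = add_mset (a + 1) (mset ?r - {#1#})"
      using that by (simp add: mset_update add.commute)
    also have "mset ?r - {#1#} = replicate_mset (m - 1) 1"
      using that by (cases m) simp_all
    finally have "mset (?r[i := ?r ! i + a]) = mset ((a + 1) # replicate (m - 1) 1)"
      by simp
    then show "mset (as @ ?r[i := ?r ! i + a]) = mset ((a + 1) # as @ replicate (m - 1) 1)"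
      by simp
  qed
  have split: "(\<Sum>i<n + m. f i) = (\<Sum>i<n. f i) + (\<Sum>i<m. f (n + i))" for f :: "nat \<Rightarrow> rat" and n
    by (induction m) (simp_all add: add.assoc)
  have "(\<Sum>i<length (as @ ?r). sol_gap ((as @ ?r)[i := (as @ ?r) ! i + a])) =
      (\<Sum>i<length as. sol_gap (as[i := as ! i + a] @ ?r)) + (\<Sum>i<m. sol_gap (as @ ?r[i := ?r ! i + a]))"
    by (simp add: split list_update_append nth_append)
  also have "(\<Sum>i<m. sol_gap (as @ ?r[i := ?r ! i + a])) =
      (\<Sum>i<m. sol_gap ((a + 1) # as @ replicate (m - 1) 1))"
    by (intro sum.cong refl tail) simp
  finally have eq: "sol_gap (a # as @ ?r) = of_bool (a = 0) * of_nat CARD('a) * sol_gap (as @ ?r)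
      - (\<Sum>i<length as. sol_gap (as[i := as ! i + a] @ ?r))
      - of_nat m * sol_gap ((a + 1) # as @ replicate (m - 1) 1)"
    unfolding sol_gap_Cons[of a "as @ ?r"] by simp
  define c :: rat where "c = (- 1) ^ m / fact m"
  have c: "norm_gap xs m = c * sol_gap (xs @ ?r)" for xs :: "'a list"
    by (simp add: norm_gap_def c_def)
  \<comment> \<open>For \<open>m = 0\<close> the factor \<open>of_nat m\<close> removes the term
    with the truncated \<open>m - 1\<close>.\<close>
  have last: "(if m = 0 then 0 else norm_gap ((a + 1) # as) (m - 1)) =
      - (c * (of_nat m * sol_gap ((a + 1) # as @ replicate (m - 1) 1)))"
    by (cases m) (simp_all add: norm_gap_def c_def del: of_nat_Suc)
  show ?thesis
    unfolding last c append_Cons eq sum_distrib_left[symmetric] by (simp only: algebra_simps)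
qed

text \<open>Iterating the recurrence raises the head by one and uses up one of the ones each time.
  With \<open>j\<close> ones left the head is \<open>a + (m - j)\<close>, and a contribution arises
  only if it is zero.\<close>

lemma norm_gap_1:
  fixes a :: "'a::{field, finite}"
  shows "norm_gap [a] m =
    of_nat CARD('a) * (\<Sum>j\<le>m. of_bool (a + of_nat (m - j) = 0) * norm_gap ([] :: 'a list) j)"
proof (induction m arbitrary: a)
  case (Suc m)
  have "a + 1 + of_nat (m - j) = a + of_nat (Suc m - j)" if "j \<le> m" for j
    using that by (simp add: Suc_diff_le)
  then show ?case
    by (subst norm_gap_Cons) (simp add: Suc algebra_simps)
qed (simp add: norm_gap_Cons)

text \<open>One of the \<open>m + 1\<close> ones is regarded as a free entry; only the normalisation
  changes. Together with \<open>norm_gap_1\<close> this gives a recursion for lists of ones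
  alone.\<close>

lemma norm_gap_Nil_Suc:
  "of_nat (Suc m) * norm_gap ([] :: 'a list) (Suc m) = - norm_gap [1 :: 'a::{field, finite}] m"
  by (simp add: norm_gap_def field_simps del: of_nat_Suc)

section \<open>Signed binomials and the gaps with at most two free entries\<close>

definition gam :: "nat \<Rightarrow> nat \<Rightarrow> rat" where
  "gam Q t = (- 1) ^ t * of_nat ((Q - 1) choose t)"

lemma gam_0 [simp]: "gam Q 0 = 1"
  by (simp add: gam_def)

lemma gam_Suc:
  assumes "Q > 0"
  shows "of_nat (Suc t) * gam Q (Suc t) = (of_nat (Suc t) - of_nat Q) * gam Q t"
proof -
  have "Suc t * ((Q - 1) choose Suc t) = (Q - 1 - t) * ((Q - 1) choose t)"
    by (metis binomial_absorb_comp binomial_absorption)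
  then have "of_nat (Suc t) * (of_nat ((Q - 1) choose Suc t) :: rat) =
      of_nat (Q - 1 - t) * of_nat ((Q - 1) choose t)"
    by (metis of_nat_mult)
  \<comment> \<open>For \<open>t > Q - 1\<close> the truncated difference is \<open>0\<close>, and
    the binomial on the right vanishes as well.\<close>
  also have "\<dots> = (of_nat Q - of_nat (Suc t)) * of_nat ((Q - 1) choose t)"
    using assms by (cases "t \<le> Q - 1") auto
  finally have eq: "of_nat (Suc t) * (of_nat ((Q - 1) choose Suc t) :: rat) =
      (of_nat Q - of_nat (Suc t)) * of_nat ((Q - 1) choose t)" .
  have "of_nat (Suc t) * gam Q (Suc t) =
      - ((- 1) ^ t * (of_nat (Suc t) * of_nat ((Q - 1) choose Suc t)))"
    by (simp add: gam_def)
  then show ?thesis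
    unfolding eq by (simp add: gam_def algebra_simps)
qed

text \<open>A term with \<open>j\<close> not divisible by \<open>p\<close> vanishes, so the partial
  sums change only at multiples of \<open>p\<close>. At \<open>m = p * Suc t\<close> the recursion
  makes the new term \<open>- Q * gam Q t / Suc t\<close>, which by \<open>gam_Suc\<close> is the
  increment \<open>gam Q (Suc t) - gam Q t\<close>.\<close>

lemma sum_norm_gap_Nil:
  fixes p Q :: nat
  assumes "p = CHAR('a::{field, finite})" "CARD('a) = p * Q" "p > 0" "Q > 0"
  shows "(\<Sum>j\<le>m. norm_gap ([] :: 'a list) j) = gam Q (m div p)"
proof (induction m rule: less_induct)
  case (less m)
  show ?case
  proof (cases m)
    case (Suc n)
    show ?thesis
    proof (cases "p dvd m")
      case False
      then have "of_nat m \<noteq> (0 :: 'a)" "m div p = n div p"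
        using assms Suc by (simp_all only: of_nat_eq_0_iff_char_dvd div_Suc dvd_eq_mod_eq_0) auto
      with norm_gap_eq_0[of "[] :: 'a list" m] show ?thesis
        using less[of n] Suc by simp
    next
      case True
      then obtain s where s: "m = p * s" by auto
      then obtain t where t: "m = p * Suc t" using Suc by (cases s) auto
      have n: "n div p = t"
      proof -
        have "Suc n = p * t + p" using t Suc by simp
        then show ?thesis using assms(3) by (intro div_nat_eqI) auto
      qed
      \<comment> \<open>Since \<open>Suc (n - j) = m - j\<close> and \<open>p\<close> divides
        \<open>m\<close>, the indicator is \<open>1\<close> whenever \<open>p\<close> divides
        \<open>j\<close>; for all other \<open>j\<close> the gap itself is zero.\<close>
      have *: "of_bool ((1 :: 'a) + of_nat (n - j) = 0) * norm_gap ([] :: 'a list) j =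
          norm_gap ([] :: 'a list) j" if "j \<le> n" for j
      proof (cases "p dvd j")
        case True
        have "Suc (n - j) = m - j" using Suc that by simp
        then have "p dvd Suc (n - j)" using True \<open>p dvd m\<close> by simp
        then have "of_nat (Suc (n - j)) = (0 :: 'a)"
          using assms by (simp only: of_nat_eq_0_iff_char_dvd)
        then show ?thesis by simp
      next
        case False
        then show ?thesis using assms by (simp add: norm_gap_eq_0 of_nat_eq_0_iff_char_dvd)
      qed
      have "of_nat m * norm_gap ([] :: 'a list) m = - (of_nat (p * Q) * gam Q t)"
      proof -
        have "(\<Sum>j\<le>n. of_bool ((1 :: 'a) + of_nat (n - j) = 0) * norm_gap ([] :: 'a list) j) = gam Q t"
          using less[of n] Suc n sum.cong[OF refl *, of "{..n}"] by simp
        then show ?thesis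
          using norm_gap_Nil_Suc[of n, where ?'a = 'a] Suc assms(2)
          by (simp only: norm_gap_1)
      qed
      moreover have "of_nat m * norm_gap ([] :: 'a list) m =
          of_nat p * (of_nat (Suc t) * norm_gap ([] :: 'a list) m)"
        unfolding t of_nat_mult by (rule mult.assoc)
      ultimately have "of_nat p * (of_nat (Suc t) * norm_gap ([] :: 'a list) m) =
          of_nat p * (- (of_nat Q * gam Q t))"
        by simp
      then have "of_nat (Suc t) * norm_gap ([] :: 'a list) m = - (of_nat Q * gam Q t)"
        using assms(3) by (simp only: mult_cancel_left of_nat_eq_0_iff) auto
      then have "of_nat (Suc t) * (norm_gap ([] :: 'a list) m + gam Q t) =
          of_nat (Suc t) * gam Q (Suc t)"
        unfolding gam_Suc[OF assms(4)] by (simp add: algebra_simps del: of_nat_Suc)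
      then have "norm_gap ([] :: 'a list) m + gam Q t = gam Q (Suc t)"
        by (simp del: of_nat_Suc)
      moreover have "m div p = Suc t" using t assms(3) by simp
      ultimately show ?thesis
        using less[of n] Suc n by (simp add: add.commute)
    qed
  qed (simp add: norm_gap_def)
qed

text \<open>As \<open>a = - m\<close> in the field, the indicator in \<open>norm_gap_1\<close>
  selects the \<open>j\<close> that are zero in the field. These are the only ones with a possibly
  nonzero term, so the full partial sum remains.\<close>

lemma norm_gap_1_closed:
  fixes a :: "'a::{field, finite}" and p Q :: nat
  assumes "p = CHAR('a)" "CARD('a) = p * Q" "p > 0" "Q > 0" "a + of_nat m = 0"
  shows "norm_gap [a] m = of_nat CARD('a) * gam Q (m div p)"
proof -
  have "of_bool (a + of_nat (m - j) = 0) * norm_gap ([] :: 'a list) j = norm_gap ([] :: 'a list) j"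
    if "j \<le> m" for j
  proof (cases "of_nat j = (0 :: 'a)")
    case True
    then show ?thesis using assms(5) that by (simp)
  qed (simp add: norm_gap_eq_0)
  then have "(\<Sum>j\<le>m. of_bool (a + of_nat (m - j) = 0) * norm_gap ([] :: 'a list) j) =
      gam Q (m div p)"
    unfolding sum_norm_gap_Nil[OF assms(1-4), symmetric] by (intro sum.cong refl) simp
  then show ?thesis by (simp only: norm_gap_1)
qed

text \<open>The recurrence moves \<open>a1\<close> to \<open>a1 + 1\<close> and \<open>m\<close> to
  \<open>m - 1\<close> while \<open>a2\<close> stays fixed. The zero sum turns \<open>a1 = 0\<close>
  into \<open>a2 + m = 0\<close>, and merging \<open>a1\<close> into \<open>a2\<close> leaves a
  one-entry gap that is already known; the two effects give the summand at
  \<open>j = m\<close>.\<close>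

lemma norm_gap_2:
  fixes a1 a2 :: "'a::{field, finite}" and p Q :: nat
  assumes "p = CHAR('a)" "CARD('a) = p * Q" "p > 0" "Q > 0" "a1 + a2 + of_nat m = 0"
  shows "norm_gap [a1, a2] m =
    of_nat CARD('a) * (\<Sum>j\<le>m. (of_nat CARD('a) * of_bool (a2 + of_nat j = 0) - 1) * gam Q (j div p))"
  using assms(5)
proof (induction m arbitrary: a1)
  case 0
  have "a1 = 0 \<longleftrightarrow> a2 = 0" using 0 by (auto simp: add_eq_0_iff)
  then show ?case using 0 norm_gap_1_closed[OF assms(1-4), of _ 0]
    by (simp add: norm_gap_Cons[of a1] algebra_simps)
next
  case (Suc m)
  have "a1 = 0 \<longleftrightarrow> a2 + of_nat (Suc m) = 0"
    using Suc.prems by (metis add.assoc add_0 add_cancel_left_right add_eq_0_iff)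
  moreover have "a1 + 1 + a2 + of_nat m = 0" using Suc.prems by (simp add: algebra_simps)
  moreover have "norm_gap [a2 + a1] (Suc m) = of_nat CARD('a) * gam Q (Suc m div p)"
    using norm_gap_1_closed[OF assms(1-4), of "a2 + a1" "Suc m"] Suc.prems by (simp add: algebra_simps)
  moreover have "norm_gap [a2] (Suc m) = of_nat CARD('a) * gam Q (Suc m div p)"
    if "a2 + of_nat (Suc m) = 0"
    by (rule norm_gap_1_closed[OF assms(1-4) that])
  ultimately show ?case
    by (subst norm_gap_Cons) (simp add: Suc.IH algebra_simps del: of_nat_Suc)
qed

section \<open>Summation over blocks of length \<open>p\<close>\<close>

lemma div_mod_Suc_cases:
  fixes n p :: nat
  assumes "p > 0"
  obtains "Suc (n mod p) < p" "Suc n div p = n div p" "Suc n mod p = Suc (n mod p)"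
  | "Suc (n mod p) = p" "Suc n div p = Suc (n div p)" "Suc n mod p = 0"
proof (cases "Suc (n mod p) = p")
  case True
  then show ?thesis using that(2) by (simp add: div_Suc mod_Suc)
next
  case False
  moreover have "n mod p < p" using assms by simp
  ultimately show ?thesis using that(1) by (simp add: div_Suc mod_Suc)
qed

text \<open>Within a block each index adds \<open>(Q - 1) * gam Q t\<close> to both sides. At the
  end of a block the right side is \<open>p * (Q - Suc t) * gam Q t\<close>, which
  \<open>gam_Suc\<close> rewrites with \<open>gam Q (Suc t)\<close>. Not dividing by
  \<open>Q - 1\<close> keeps \<open>Q = 1\<close> included.\<close>

lemma sum_gam:
  assumes "p > 0" "Q > 0"
  shows "(of_nat Q - 1) * (\<Sum>j\<le>m. gam Q (j div p)) =
    gam Q (m div p) * ((of_nat Q - 1) * (of_nat (m mod p) + 1) - of_nat p * of_nat (m div p))"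
proof (induction m)
  case (Suc m)
  from assms(1) show ?case
  proof (cases rule: div_mod_Suc_cases[of p m])
    case 1
    then show ?thesis using Suc by (simp add: algebra_simps)
  next
    case 2
    define t where "t = m div p"
    have r: "of_nat (m mod p) + 1 = (of_nat p :: rat)" using 2(1)
      by (metis of_nat_Suc add.commute)
    have "(of_nat Q - 1) * (\<Sum>j\<le>Suc m. gam Q (j div p)) =
        of_nat p * ((of_nat Q - of_nat (Suc t)) * gam Q t) + (of_nat Q - 1) * gam Q (Suc t)"
      using Suc 2 unfolding r t_def[symmetric] by (simp add: algebra_simps)
    also have "(of_nat Q - of_nat (Suc t)) * gam Q t = - (of_nat (Suc t) * gam Q (Suc t))"
      unfolding gam_Suc[OF assms(2)] by (simp add: algebra_simps)
    finally show ?thesis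
      using 2 by (simp add: t_def algebra_simps)
  qed
qed (simp add: assms)

text \<open>Every complete block meets the residue \<open>j0\<close> once and adds
  \<open>p * (Q - 1) * gam Q t\<close>, which telescopes by \<open>gam_Suc\<close>. The indicator on
  the right records whether the current incomplete block has already passed
  \<open>j0\<close>.\<close>

lemma sum_gam_residue:
  assumes "p > 0" "Q > 0" "j0 < p"
  shows "(\<Sum>j<n. (of_nat (p * Q) * of_bool (j mod p = j0) - 1) * gam Q (j div p)) =
    - gam Q (n div p) * (of_nat n - of_nat (p * Q) * of_bool (n mod p > j0))"
proof (induction n)
  case (Suc n)
  from assms(1) show ?case
  proof (cases rule: div_mod_Suc_cases[of p n])
    case 1
    have "of_bool (Suc n mod p > j0) = (of_bool (n mod p > j0) + of_bool (n mod p = j0) :: rat)"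
      using 1 by auto
    then show ?thesis using Suc 1 by (simp only: sum.lessThan_Suc) (simp add: algebra_simps)
  next
    case 2
    define t where "t = n div p"
    \<comment> \<open>Here \<open>n\<close> is the last index of its block, so \<open>j0\<close>
      occurred either earlier in the block or at \<open>n\<close> itself.\<close>
    have r: "of_bool (n mod p > j0) + of_bool (n mod p = j0) = (1 :: rat)" using 2 assms by auto
    have n: "Suc n = p * Suc t" using 2 by (metis add.right_neutral mult_div_mod_eq t_def)
    have "(\<Sum>j<Suc n. (of_nat (p * Q) * of_bool (j mod p = j0) - 1) * gam Q (j div p)) =
        of_nat (p * Q) * gam Q t * (of_bool (n mod p > j0) + of_bool (n mod p = j0))
          - gam Q t * of_nat (Suc n)"
      using Suc by (simp add: t_def algebra_simps)
    also have "\<dots> = - (of_nat p * ((of_nat (Suc t) - of_nat Q) * gam Q t))"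
      unfolding r n by (simp add: algebra_simps)
    also have "\<dots> = - (of_nat p * (of_nat (Suc t) * gam Q (Suc t)))"
      unfolding gam_Suc[OF assms(2)] by simp
    also have "\<dots> = - gam Q (Suc n div p) * (of_nat (Suc n) - of_nat (p * Q) * of_bool (Suc n mod p > j0))"
      using 2 n by (simp add: t_def algebra_simps)
    finally show ?thesis .
  qed
qed (simp add: assms)

section \<open>The prime field, least residues and the set \<open>A_set\<close>\<close>

lemma prime_field_eq:
  "prime_field = (of_nat ` {..<CHAR('a)} :: 'a::{field, finite} set)"
proof -
  have p: "CHAR('a) > 0" by (rule finite_imp_CHAR_pos) simp
  have "of_int z \<in> (of_nat ` {..<CHAR('a)} :: 'a set)" for z
  proof (rule image_eqI[where x = "nat (z mod int CHAR('a))"])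
    have "(of_nat (nat (z mod int CHAR('a))) :: 'a) = of_int (z mod int CHAR('a))"
      using p by simp
    also have "\<dots> = of_int z"
      by (subst (2) mult_div_mod_eq[symmetric, of _ "int CHAR('a)"])
         (simp only: of_int_add of_int_mult of_int_of_nat_eq of_nat_CHAR, simp)
    finally show "of_int z = (of_nat (nat (z mod int CHAR('a))) :: 'a)" ..
  qed (use p in \<open>simp add: nat_less_iff\<close>)
  moreover have "of_nat n \<in> (range of_int :: 'a set)" for n
    by (metis of_int_of_nat_eq rangeI)
  ultimately show ?thesis by (auto simp: prime_field_def)
qed

lemma least_residue_of_nat:
  "least_residue (of_nat n :: 'a::{field, finite}) = n mod CHAR('a)"
  unfolding least_residue_def
proof (rule Least_equality)
  show "of_nat (n mod CHAR('a)) = (of_nat n :: 'a)"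
    by (simp add: of_nat_eq_iff_cong_CHAR)
next
  fix m assume "of_nat m = (of_nat n :: 'a)"
  then have "m mod CHAR('a) = n mod CHAR('a)" by (simp add: of_nat_eq_iff_cong_CHAR cong_def)
  then show "n mod CHAR('a) \<le> m" by (metis mod_less_eq_dividend)
qed

text \<open>With \<open>R\<close> the residue of \<open>m + 1\<close>, the sum
  \<open>n1 + n2 + R\<close> is congruent to \<open>1\<close> and all three summands are below
  \<open>p\<close>, so it is \<open>1\<close>, \<open>p + 1\<close> or \<open>2 * p + 1\<close>. The
  equivalence is then checked case by case.\<close>

lemma residue_sum_le_iff:
  fixes p n1 n2 m :: nat
  assumes "2 \<le> p" "n1 < p" "n2 < p" "p dvd n1 + n2 + m"
  shows "(Suc p - n1) mod p \<noteq> 0 \<and> (Suc p - n2) mod p \<noteq> 0 \<and>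
      (Suc p - n1) mod p + (Suc p - n2) mod p \<le> p \<longleftrightarrow> (p - n2) mod p < Suc m mod p"
proof -
  define R where "R = Suc m mod p"
  have R: "R < p" using assms(1) by (simp add: R_def)
  have "(n1 + n2 + R) mod p = (n1 + n2 + m + 1) mod p"
    by (simp add: R_def mod_add_right_eq)
  also have "\<dots> = 1"
    using assms(1,4) by (subst mod_add_left_eq[symmetric]) (simp add: dvd_eq_mod_eq_0)
  finally obtain c where c: "n1 + n2 + R = c * p + 1"
    by (metis div_mult_mod_eq)
  have "c < 3"
  proof (rule ccontr)
    assume "\<not> c < 3"
    then have "3 * p \<le> c * p" by simp
    then show False using c assms(2,3) R by linarith
  qed
  then have "c = 0 \<or> c = 1 \<or> c = 2" by auto
  then have c': "n1 + n2 + R = 1 \<or> n1 + n2 + R = p + 1 \<or> n1 + n2 + R = 2 * p + 1"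
    using c by auto
  have A: "(Suc p - n) mod p = (if n = 0 then 1 else if n = 1 then 0 else Suc p - n)" if "n < p" for n
    using that assms(1) by (auto simp: mod_Suc)
  have B: "(p - n2) mod p = (if n2 = 0 then 0 else p - n2)"
    using assms(3) by auto
  show ?thesis
    unfolding A[OF assms(2)] A[OF assms(3)] B R_def[symmetric]
    using c' assms(1-3) R by (auto split: if_splits)
qed

text \<open>Membership in \<open>A_set\<close> becomes the comparison that
  \<open>sum_gam_residue\<close> produces: the residue of \<open>- a2\<close> lies below that of
  \<open>m + 1\<close>.\<close>

lemma mem_A_set_iff:
  assumes "p = CHAR('a::{field, finite})" "n1 < p" "n2 < p"
    and "of_nat n1 + of_nat n2 + of_nat m = (0 :: 'a)"
  shows "(of_nat n1, of_nat n2 :: 'a) \<in> A_set \<longleftrightarrow> (p - n2) mod p < Suc m mod p"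
proof -
  have "p > 0" unfolding assms(1) by (rule finite_imp_CHAR_pos) simp
  moreover have "p \<noteq> 1" unfolding assms(1) by simp
  ultimately have "2 \<le> p" by simp
  \<comment> \<open>Adding \<open>p\<close>, which is zero in the field, avoids truncated
    subtraction.\<close>
  have one_minus: "1 - of_nat n = (of_nat (Suc p - n) :: 'a)" if "n < p" for n
    using that assms(1) by (simp)
  have eq_1: "of_nat n = (1 :: 'a) \<longleftrightarrow> (Suc p - n) mod p = 0" if "n < p" for n
  proof -
    have "of_nat n = (1 :: 'a) \<longleftrightarrow> 1 - of_nat n = (0 :: 'a)" by auto
    then show ?thesis
      unfolding one_minus[OF that] of_nat_eq_0_iff_char_dvd assms(1) dvd_eq_mod_eq_0 .
  qed
  have "p dvd n1 + n2 + m"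
    using assms(1,4) by (simp add: of_nat_eq_0_iff_char_dvd flip: of_nat_add)
  from residue_sum_le_iff[OF \<open>2 \<le> p\<close> assms(2,3) this] show ?thesis
    unfolding A_set_def mem_Collect_eq case_prod_conv one_minus[OF assms(2)] one_minus[OF assms(3)]
      eq_1[OF assms(2)] eq_1[OF assms(3)] least_residue_of_nat assms(1)[symmetric]
    using assms(1-3) by (auto simp: prime_field_eq)
qed

lemma add_of_nat_eq_0_iff:
  assumes "p = CHAR('a::{field, finite})" "n < p"
  shows "of_nat n + of_nat j = (0 :: 'a) \<longleftrightarrow> j mod p = (p - n) mod p"
proof -
  have "of_nat n + of_nat j = (0 :: 'a) \<longleftrightarrow> of_nat j = (of_nat (p - n) :: 'a)"
    using assms by (auto simp: add_eq_0_iff)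
  then show ?thesis
    using assms(1) by (simp add: of_nat_eq_iff_cong_CHAR cong_def)
qed

section \<open>Closed forms for two free entries and the final count\<close>

lemma norm_gap_2_not_prime_field:
  fixes a1 a2 :: "'a::{field, finite}" and p Q m :: nat
  assumes "p = CHAR('a)" "CARD('a) = p * Q" "p > 0" "Q > 0" "a1 + a2 + of_nat m = 0"
    and "a2 \<notin> prime_field"
  shows "norm_gap [a1, a2] m = - of_nat CARD('a) * gam Q (m div p) *
    ((of_nat CARD('a) * of_nat (m mod p) - of_nat p * of_nat m) / (of_nat CARD('a) - of_nat p) + 1)"
proof -
  have "a2 + of_nat j \<noteq> 0" for j
  proof
    assume "a2 + of_nat j = 0"
    then have "a2 = of_int (- int j)" by (simp add: eq_neg_iff_add_eq_0)
    then show False using assms(6) unfolding prime_field_def by (metis rangeI)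
  qed
  then have gap: "norm_gap [a1, a2] m = - of_nat CARD('a) * (\<Sum>j\<le>m. gam Q (j div p))"
    by (simp add: norm_gap_2[OF assms(1-5)] sum_negf)
  \<comment> \<open>If \<open>Q = 1\<close>, the prime field would be the whole field and contain
    \<open>a2\<close>. Hence the denominator \<open>q - p\<close> is nonzero.\<close>
  have "Q \<noteq> 1"
  proof
    assume "Q = 1"
    have "inj_on (of_nat :: nat \<Rightarrow> 'a) {..<CHAR('a)}"
      by (auto simp: inj_on_def of_nat_eq_iff_cong_CHAR cong_def)
    then have "card (prime_field :: 'a set) = CARD('a)"
      using \<open>Q = 1\<close> assms(1,2) by (simp add: prime_field_eq card_image)
    then have "prime_field = (UNIV :: 'a set)"
      by (intro card_subset_eq) auto
    then show False using assms(6) by simp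
  qed
  \<comment> \<open>In these terms \<open>q = s * (x + 1)\<close>, so \<open>q - p\<close> is
    \<open>s * x\<close> and the factor \<open>s\<close> cancels from the fraction.\<close>
  define x s r t :: rat where "x = of_nat Q - 1" and "s = of_nat p"
    and "r = of_nat (m mod p)" and "t = of_nat (m div p)"
  have nz: "x \<noteq> 0" "s \<noteq> 0" using \<open>Q \<noteq> 1\<close> assms(3) by (simp_all add: x_def s_def)
  have q: "of_nat CARD('a) = s * (x + 1)" by (simp add: assms(2) s_def x_def)
  have m: "of_nat m = s * t + r"
    unfolding s_def t_def r_def of_nat_mult[symmetric] of_nat_add[symmetric] by simp
  have sum: "x * (\<Sum>j\<le>m. gam Q (j div p)) = gam Q (m div p) * (x * (r + 1) - s * t)"
    using sum_gam[OF assms(3,4), of m] by (simp add: x_def s_def r_def t_def)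
  have frac: "(s * (x + 1) * r - s * (s * t + r)) / (s * (x + 1) - s) + 1 = (x * (r + 1) - s * t) / x"
    using nz by (simp add: field_simps)
  have "(\<Sum>j\<le>m. gam Q (j div p)) = gam Q (m div p) * ((x * (r + 1) - s * t) / x)"
    using sum nz(1) by (simp add: eq_divide_eq mult.commute)
  then show ?thesis
    unfolding gap q m s_def[symmetric] r_def[symmetric] frac by (simp only: mult.assoc)
qed

lemma norm_gap_2_prime_field:
  fixes a1 a2 :: "'a::{field, finite}" and p Q m :: nat
  assumes "p = CHAR('a)" "CARD('a) = p * Q" "p > 0" "Q > 0" "a1 + a2 + of_nat m = 0"
    and "a1 \<in> prime_field" "a2 \<in> prime_field"
  shows "norm_gap [a1, a2] m = - of_nat CARD('a) * gam Q (Suc m div p) *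
    (of_nat (Suc m) - of_nat CARD('a) * indicator A_set (a1, a2))"
proof -
  obtain n1 n2 where n: "n1 < p" "n2 < p" "a1 = of_nat n1" "a2 = of_nat n2"
    using assms(1,6,7) by (auto simp: prime_field_eq)
  \<comment> \<open>The residue of \<open>- a2\<close> is \<open>(p - n2) mod p\<close>, where the
    outer \<open>mod\<close> covers \<open>n2 = 0\<close>. Rewriting \<open>j \<le> m\<close> as
    \<open>j < Suc m\<close> is the source of \<open>k - 1\<close> in the third formula.\<close>
  have "(\<Sum>j\<le>m. (of_nat CARD('a) * of_bool (a2 + of_nat j = 0) - 1) * gam Q (j div p)) =
      (\<Sum>j<Suc m. (of_nat (p * Q) * of_bool (j mod p = (p - n2) mod p) - 1) * gam Q (j div p))"
    unfolding assms(2) n(4) add_of_nat_eq_0_iff[OF assms(1) n(2)] lessThan_Suc_atMost ..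
  also have "\<dots> = - gam Q (Suc m div p) *
      (of_nat (Suc m) - of_nat (p * Q) * of_bool ((p - n2) mod p < Suc m mod p))"
    using assms(3,4) by (intro sum_gam_residue) auto
  also have "of_bool ((p - n2) mod p < Suc m mod p) = (indicator A_set (a1, a2) :: rat)"
    using mem_A_set_iff[OF assms(1) n(1,2), of m] assms(5) n(3,4) by (simp add: indicator_def)
  finally have sum: "(\<Sum>j\<le>m. (of_nat CARD('a) * of_bool (a2 + of_nat j = 0) - 1) * gam Q (j div p)) =
      - gam Q (Suc m div p) * (of_nat (Suc m) - of_nat (p * Q) * indicator A_set (a1, a2))" .
  show ?thesis
    unfolding norm_gap_2[OF assms(1-5)] sum by (simp add: assms(2) mult.assoc)
qed

theorem theorem1p6:
  fixes a1 a2 b :: "'a::{field, finite}" and k p q :: nat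
  assumes "q = CARD('a)" and "p = CHAR('a)" and "k \<ge> 2"
  shows "(a1 + a2 + of_nat (k - 2) \<noteq> 0 \<longrightarrow>
      (of_nat (num_distinct_sols (a1 # a2 # replicate (k - 2) 1) b) :: rat) =
        1 / of_nat q * falling_fact q k)
    \<and> (a1 + a2 + of_nat (k - 2) = 0 \<and> a1 \<notin> prime_field \<and> a2 \<notin> prime_field \<longrightarrow>
      (of_nat (num_distinct_sols (a1 # a2 # replicate (k - 2) 1) b) :: rat) =
        1 / of_nat q * falling_fact q k +
        of_int (v_fun b) * (- 1) ^ (k - 1 + (k - 2) div p) * fact (k - 2) *
        ((of_nat q * of_nat ((k - 2) mod p) - of_nat p * of_nat (k - 2)) /
           (of_nat q - of_nat p) + 1) *
        of_nat ((q div p - 1) choose ((k - 2) div p)))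
    \<and> (a1 + a2 + of_nat (k - 2) = 0 \<and> a1 \<in> prime_field \<and> a2 \<in> prime_field \<longrightarrow>
      (of_nat (num_distinct_sols (a1 # a2 # replicate (k - 2) 1) b) :: rat) =
        1 / of_nat q * falling_fact q k +
        of_int (v_fun b) * (- 1) ^ (k - 1 + (k - 1) div p) * fact (k - 2) *
        (of_nat k - 1 - of_nat q * indicator A_set (a1, a2)) *
        of_nat ((q div p - 1) choose ((k - 1) div p)))"
proof -
  have q: "q = CARD('a)" and p: "p = CHAR('a)" by fact+
  have "p > 0" unfolding p by (rule finite_imp_CHAR_pos) simp
  define Q where "Q = q div p"
  have Q: "CARD('a) = p * Q"
    using CHAR_dvd_CARD[where ?'a = 'a] by (simp add: Q_def p q)
  then have "Q > 0" by (metis zero_less_card_finite mult_0_right neq0_conv)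
  note pQ = p Q \<open>p > 0\<close> \<open>Q > 0\<close>
  have q0: "(of_nat q :: rat) \<noteq> 0" by (simp add: q)
  define m where "m = k - 2"
  have k: "k = Suc (Suc m)" using \<open>k \<ge> 2\<close> by (simp add: m_def)
  let ?as = "a1 # a2 # replicate m 1"
  have N: "of_nat (num_distinct_sols ?as b) =
      1 / of_nat q * falling_fact q k + of_int (v_fun b) * (sol_gap ?as / of_nat q)"
    using num_distinct_sols_conv_sol_gap[of ?as b] by (simp add: q k)
  have gap: "sol_gap ?as = (- 1) ^ m * fact m * norm_gap [a1, a2] m"
    by (simp add: norm_gap_def flip: power_mult_distrib)
  have 1: "sol_gap ?as = 0" if "a1 + a2 + of_nat m \<noteq> 0"
    using that by (intro sol_gap_eq_0) (simp add: sum_list_replicate add.assoc)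
  \<comment> \<open>The minus sign of the closed form and \<open>(- 1) ^ m\<close> combine to
    \<open>(- 1) ^ (k - 1)\<close>; the rest of the exponent comes from \<open>gam\<close>.\<close>
  have 2: "sol_gap ?as / of_nat q = (- 1) ^ (k - 1 + m div p) * fact m *
      ((of_nat q * of_nat (m mod p) - of_nat p * of_nat m) / (of_nat q - of_nat p) + 1) *
      of_nat ((q div p - 1) choose (m div p))"
    if "a1 + a2 + of_nat m = 0" "a2 \<notin> prime_field"
    using q0 unfolding gap norm_gap_2_not_prime_field[OF pQ that] gam_def q[symmetric] Q_def[symmetric]
    by (simp add: k power_add)
  have 3: "sol_gap ?as / of_nat q = (- 1) ^ (k - 1 + (k - 1) div p) * fact m *
      (of_nat k - 1 - of_nat q * indicator A_set (a1, a2)) *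
      of_nat ((q div p - 1) choose ((k - 1) div p))"
    if "a1 + a2 + of_nat m = 0" "a1 \<in> prime_field" "a2 \<in> prime_field"
    using q0 unfolding gap norm_gap_2_prime_field[OF pQ that] gam_def q[symmetric] Q_def[symmetric]
    by (simp add: k power_add)
  show ?thesis
    unfolding m_def[symmetric] N using 1 2 3 by (simp add: mult.assoc)
qed

end
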